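(* Every directed graph $G$ has a subdivision $\tilde G$ that satisfies property (P2).
   Context: A subdivision of a directed graph is obtained by replacing edges $xy$ by directed $x$-$y$-paths with new internal vertices. For an edge $e=uv$ of a directed graph $H$, $P_H(e)$ denotes the subgraph of $H$ induced by all edges lying on directed $u$-$v$-paths in $H$. Property (P2) for $H$: the edge sets $\{E(P_H(e))\}_{e\in E(H)}$ form a laminar family, i.e., for all edges $e_1,e_2\in E(H)$, $P_H(e_1)\subseteq P_H(e_2)$ or $P_H(e_2)\subseteq P_H(e_1)$ or $E(P_H(e_1))\cap E(P_H(e_2))=\emptyset$. *)

theory Defs
  imports "Graph_Theory.Graph_Theory"
begin

text \<open>
  The constant \<^const>\<open>subdivision\<close> of the library is restricted to bidirected digraphs, so
  subdivisions of arbitrary directed multigraphs (possibly infinite, loops allowed) are defined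
  here. Since \<open>H\<close> may have other types of vertices and arcs than \<open>G\<close>, the vertices of \<open>G\<close> are
  embedded into \<open>H\<close> by \<open>f\<close>; the arc \<open>a\<close> is replaced by the path \<open>p a\<close>. Such a path may have
  length one (the arc is kept). A loop is replaced by a closed walk whose inner vertices are
  distinct, which is why \<^const>\<open>pre_digraph.apath\<close> is not used for \<open>p a\<close>; if \<open>a\<close> is not a
  loop, the conditions imply that \<open>p a\<close> is a path.
  The disjointness of the arc sets is needed for paths without inner vertices: it prevents
  parallel arcs from being identified.
\<close>

definition digraph_subdivision :: "('a, 'b) pre_digraph \<Rightarrow> ('c, 'd) pre_digraph \<Rightarrow> bool" where
  "digraph_subdivision G H \<longleftrightarrow>
     wf_digraph G \<and> wf_digraph H \<and>
     (\<exists>(f :: 'a \<Rightarrow> 'c) (p :: 'b \<Rightarrow> 'd awalk).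
        inj_on f (verts G) \<and>
        (\<forall>a \<in> arcs G.
           p a \<noteq> [] \<and>
           pre_digraph.awalk H (f (tail G a)) (p a) (f (head G a)) \<and>
           distinct (pre_digraph.inner_verts H (p a)) \<and>
           set (pre_digraph.inner_verts H (p a)) \<inter> f ` verts G = {}) \<and>
        (\<forall>a \<in> arcs G. \<forall>b \<in> arcs G. a \<noteq> b \<longrightarrow>
           set (p a) \<inter> set (p b) = {} \<and>
           set (pre_digraph.inner_verts H (p a)) \<inter> set (pre_digraph.inner_verts H (p b)) = {}) \<and>
        verts H = f ` verts G \<union> (\<Union>a \<in> arcs G. set (pre_digraph.inner_verts H (p a))) \<and>
        arcs H = (\<Union>a \<in> arcs G. set (p a)))"

definition arc_induced_subgraph :: "('a, 'b) pre_digraph \<Rightarrow> 'b set \<Rightarrow> ('a, 'b) pre_digraph" where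
  "arc_induced_subgraph H A =
     \<lparr> verts = tail H ` A \<union> head H ` A, arcs = A, tail = tail H, head = head H \<rparr>"

text \<open>
  For \<open>e = uv\<close>, the subgraph induced by all arcs on directed \<open>u\<close>-\<open>v\<close>-paths. Paths do not repeat
  vertices; in particular, if \<open>e\<close> is a loop, the only such path is the trivial one.
\<close>

definition path_subgraph :: "('a, 'b) pre_digraph \<Rightarrow> 'b \<Rightarrow> ('a, 'b) pre_digraph" where
  "path_subgraph H e =
     arc_induced_subgraph H
       {a \<in> arcs H. \<exists>p. pre_digraph.apath H (tail H e) p (head H e) \<and> a \<in> set p}"

definition property_P2 :: "('a, 'b) pre_digraph \<Rightarrow> bool" where
  "property_P2 H \<longleftrightarrow>
     (\<forall>e1 \<in> arcs H. \<forall>e2 \<in> arcs H.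
        subgraph (path_subgraph H e1) (path_subgraph H e2) \<or>
        subgraph (path_subgraph H e2) (path_subgraph H e1) \<or>
        arcs (path_subgraph H e1) \<inter> arcs (path_subgraph H e2) = {})"

end

theory Submission
  imports Defs
begin

text \<open>
  Replace every arc by a path of length two. The midpoint of such a path has a single in-arc and
  a single out-arc, so each arc of the subdivision is the only path between its own ends: any
  other walk would pass twice through the end that is a vertex of the original graph. Hence all
  the path subgraphs consist of a single arc.
\<close>

text \<open>Index 0 marks the half entering the midpoint of \<open>e\<close>, index 1 the half
  leaving it. Midpoints are tagged \<open>(e, 0)\<close> to match the vertex type in the
  theorem.\<close>

definition halve_arcs :: "('v, 'e) pre_digraph \<Rightarrow> ('v + 'e \<times> nat, 'e \<times> nat) pre_digraph" where
  "halve_arcs G =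
     \<lparr> verts = Inl ` verts G \<union> (\<lambda>e. Inr (e, 0)) ` arcs G,
       arcs = arcs G \<times> {0, 1},
       tail = (\<lambda>(e, i). if i = 0 then Inl (tail G e) else Inr (e, 0)),
       head = (\<lambda>(e, i). if i = 0 then Inr (e, 0) else Inl (head G e)) \<rparr>"

lemma halve_arcs_simps [simp]:
  "verts (halve_arcs G) = Inl ` verts G \<union> (\<lambda>e. Inr (e, 0)) ` arcs G"
  "arcs (halve_arcs G) = arcs G \<times> {0, 1}"
  "tail (halve_arcs G) (e, i) = (if i = 0 then Inl (tail G e) else Inr (e, 0))"
  "head (halve_arcs G) (e, i) = (if i = 0 then Inr (e, 0) else Inl (head G e))"
  by (simp_all add: halve_arcs_def)

lemma wf_digraph_halve_arcs:
  assumes "wf_digraph G"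
  shows "wf_digraph (halve_arcs G)"
  using assms by (auto simp: wf_digraph_def)

lemma inner_verts_halve_arcs:
  "pre_digraph.inner_verts (halve_arcs G) [(e, 0), (e, Suc 0)] = [Inr (e, 0)]"
  by (simp add: pre_digraph.inner_verts_def)

lemma digraph_subdivision_halve_arcs:
  assumes "wf_digraph G"
  shows "digraph_subdivision G (halve_arcs G)"
proof -
  interpret G: wf_digraph G by fact
  interpret H: wf_digraph "halve_arcs G" using assms by (rule wf_digraph_halve_arcs)
  show ?thesis
    unfolding digraph_subdivision_def
  proof (intro conjI exI)
    \<comment> \<open>Unification with this conjunct fixes both witnesses: \<open>Inl\<close> embeds
      the vertices, and \<open>a\<close> becomes its two halves in order.\<close>
    show "\<forall>a\<in>arcs G. [(a, 0), (a, 1)] \<noteq> [] \<and>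
        H.awalk (Inl (tail G a)) [(a, 0), (a, 1)] (Inl (head G a)) \<and>
        distinct (H.inner_verts [(a, 0), (a, 1)]) \<and>
        set (H.inner_verts [(a, 0), (a, 1)]) \<inter> Inl ` verts G = {}"
      by (auto simp: inner_verts_halve_arcs H.awalk_Cons_iff H.awalk_Nil_iff)
  qed (use assms wf_digraph_halve_arcs in \<open>auto simp: inner_verts_halve_arcs\<close>)
qed

text \<open>A nontrivial path must end with the only arc into its end vertex, namely
  \<open>e\<close>. What precedes \<open>e\<close> is a path from \<open>tail G e\<close> to itself,
  hence empty.\<close>

lemma (in wf_digraph) apath_unique_in_arc:
  assumes "apath (tail G e) p (head G e)" and "tail G e \<noteq> head G e"
    and "\<And>a. a \<in> arcs G \<Longrightarrow> head G a = head G e \<Longrightarrow> a = e"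
  shows "p = [e]"
proof (cases p rule: rev_cases)
  case Nil
  with assms show ?thesis by (simp add: apath_Nil_iff)
next
  case (snoc q a)
  with assms(1) have "a \<in> arcs G" "head G a = head G e"
    and q: "apath (tail G e) q (tail G a)"
    by (auto simp: apath_append_iff apath_simps awalk_simps)
  with assms(3) have "a = e" by blast
  with q snoc show ?thesis using apath_ends[of "tail G e" q "tail G e"] by auto
qed

text \<open>Dual argument: the first arc is forced to be \<open>e\<close>, and the rest is a path
  from \<open>head G e\<close> to itself.\<close>

lemma (in wf_digraph) apath_unique_out_arc:
  assumes "apath (tail G e) p (head G e)" and "tail G e \<noteq> head G e"
    and "\<And>a. a \<in> arcs G \<Longrightarrow> tail G a = tail G e \<Longrightarrow> a = e"
  shows "p = [e]"
proof (cases p)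
  case Nil
  with assms show ?thesis by (simp add: apath_Nil_iff)
next
  case (Cons a q)
  with assms(1) have "a \<in> arcs G" "tail G a = tail G e"
    and q: "apath (head G a) q (head G e)"
    by (auto simp: apath_Cons_iff)
  with assms(3) have "a = e" by blast
  with q Cons show ?thesis using apath_ends[of "head G e" q "head G e"] by auto
qed

text \<open>The vertices are by construction the ends of the arcs in \<open>A\<close>. This serves
  the reflexivity of \<open>subgraph\<close>, which demands well-formedness.\<close>

lemma (in wf_digraph) wf_digraph_arc_induced_subgraph: "wf_digraph (arc_induced_subgraph G A)"
  by unfold_locales (auto simp: arc_induced_subgraph_def)

lemma (in wf_digraph) property_P2_if_arcs_path_subgraph_singleton:
  assumes "\<And>e. e \<in> arcs G \<Longrightarrow> arcs (path_subgraph G e) \<subseteq> {e}"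
  shows "property_P2 G"
  unfolding property_P2_def
proof (intro ballI)
  fix e1 e2 assume e: "e1 \<in> arcs G" "e2 \<in> arcs G"
  have "subgraph (path_subgraph G e) (path_subgraph G e)" for e
    by (simp add: path_subgraph_def subgraph_def wf_digraph_arc_induced_subgraph compatible_def)
  with assms[OF e(1)] assms[OF e(2)]
  show "subgraph (path_subgraph G e1) (path_subgraph G e2) \<or>
        subgraph (path_subgraph G e2) (path_subgraph G e1) \<or>
        arcs (path_subgraph G e1) \<inter> arcs (path_subgraph G e2) = {}"
    by (cases "e1 = e2") auto
qed

lemma property_P2_halve_arcs:
  assumes "wf_digraph G"
  shows "property_P2 (halve_arcs G)"
proof -
  interpret H: wf_digraph "halve_arcs G" using assms by (rule wf_digraph_halve_arcs)
  show ?thesis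
  proof (rule H.property_P2_if_arcs_path_subgraph_singleton)
    fix x assume x: "x \<in> arcs (halve_arcs G)"
    have "p = [x]" if "H.apath (tail (halve_arcs G) x) p (head (halve_arcs G) x)" for p
    \<comment> \<open>A first half is the only arc into its midpoint, a second half the only arc out
      of it. The ends of \<open>x\<close> differ even if the original arc is a loop, one being an
      \<open>Inl\<close> and the other an \<open>Inr\<close>.\<close>
    proof (cases "snd x = 0")
      case True
      with that show ?thesis by (intro H.apath_unique_in_arc) (cases x, auto split: if_splits)+
    next
      case False
      \<comment> \<open>As \<open>x\<close> is an arc, its nonzero index is 1, so it is the only arc
        leaving the midpoint.\<close>
      with that x show ?thesis by (intro H.apath_unique_out_arc) (cases x, auto split: if_splits)+
    qed
    then show "arcs (path_subgraph (halve_arcs G) x) \<subseteq> {x}"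
      by (force simp: path_subgraph_def arc_induced_subgraph_def)
  qed
qed

theorem theorem4:
  fixes G :: "('v, 'e) pre_digraph"
  assumes "wf_digraph G"
  shows "\<exists>H :: ('v + 'e \<times> nat, 'e \<times> nat) pre_digraph.
           digraph_subdivision G H \<and> property_P2 H"
  using assms digraph_subdivision_halve_arcs property_P2_halve_arcs by blast

end
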